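(* Let $d\ge1$ be an integer, let $\alpha\in(0,d)$, and let $\frac{2d}{\alpha}<p<\infty$. Then there exist a sequence of functions $f_N:\mathbb{Z}_N^d\to\mathbb{C}$, $N\in\mathbb{N}$, with $|\operatorname{supp}(\widehat{f_N})|\approx N^\alpha$, and constants $C>0$ and $C_0>0$ independent of $N$, such that $$\|f_N\|_{L^p(\mathbb{Z}_N^d)}\le C\quad\text{and}\quad\|f_N\|_{L^\infty(\mathbb{Z}_N^d)}>C_0$$ for all $N\in\mathbb{N}$.
   Context: $\mathbb{Z}_N^d$ is the $d$-fold product of the cyclic group $\mathbb{Z}_N=\mathbb{Z}/N\mathbb{Z}$; $\mathbb{N}$ is the set of positive integers. For $f:\mathbb{Z}_N^d\to\mathbb{C}$ the Fourier transform $\widehat f:\mathbb{Z}_N^d\to\mathbb{C}$ is $\widehat f(m)=N^{-d/2}\sum_{x\in\mathbb{Z}_N^d} f(x)e^{-2\pi i\, x\cdot m/N}$, where $x\cdot m=\sum_{j=1}^d x_jm_j$. Norms are with respect to counting measure: $\|f\|_{L^p(\mathbb{Z}_N^d)}=\left(\sum_{x\in\mathbb{Z}_N^d}|f(x)|^p\right)^{1/p}$ for $1\le p<\infty$ and $\|f\|_{L^\infty(\mathbb{Z}_N^d)}=\max_{x\in\mathbb{Z}_N^d}|f(x)|$. $\operatorname{supp}$ denotes the set of points where a function is nonzero. The notation $|\operatorname{supp}(\widehat{f_N})|\approx N^\alpha$ means that there are constants $C_1,C_2>0$ independent of $N$ with $C_1N^\alpha\le|\operatorname{supp}(\widehat{f_N})|\le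 C_2N^\alpha$ for all $N$. *)

theory Defs
  imports Complex_Main "HOL-Algebra.Elementary_Groups" "HOL-Algebra.Product_Groups"
begin

(* For N > 0 the elements of Z_N^d are represented by their coordinates in {0..<N},
   indexed by {1..d} (and undefined outside). For N = 0 the library's cyclic group is
   the infinite one, so all uses below are for N > 0. *)
definition ZN_group :: "nat \<Rightarrow> nat \<Rightarrow> (nat \<Rightarrow> int) monoid" where
  "ZN_group N d = product_group {1..d} (\<lambda>_. integer_mod_group N)"

abbreviation ZN :: "nat \<Rightarrow> nat \<Rightarrow> (nat \<Rightarrow> int) set" where
  "ZN N d \<equiv> carrier (ZN_group N d)"

lemma ZN_eq: "N > 0 \<Longrightarrow> ZN N d = ({1..d} \<rightarrow>\<^sub>E {0..<int N})"
  by (simp add: ZN_group_def carrier_integer_mod_group)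

lemma finite_ZN: "N > 0 \<Longrightarrow> finite (ZN N d)"
  by (simp add: ZN_eq finite_PiE)

lemma card_ZN: "N > 0 \<Longrightarrow> card (ZN N d) = N ^ d"
  by (simp add: ZN_eq card_PiE)

(* An integer; only its residue modulo N matters in the Fourier transform. *)
definition dot :: "nat \<Rightarrow> (nat \<Rightarrow> int) \<Rightarrow> (nat \<Rightarrow> int) \<Rightarrow> int" where
  "dot d x m = (\<Sum>j = 1..d. x j * m j)"

definition fourier :: "nat \<Rightarrow> nat \<Rightarrow> ((nat \<Rightarrow> int) \<Rightarrow> complex) \<Rightarrow> (nat \<Rightarrow> int) \<Rightarrow> complex" where
  "fourier N d f m =
     of_real (real N powr (- (real d / 2))) *
     (\<Sum>x\<in>ZN N d. f x * exp (- 2 * of_real pi * \<i> * of_int (dot d x m) / of_nat N))"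

definition supp :: "nat \<Rightarrow> nat \<Rightarrow> ((nat \<Rightarrow> int) \<Rightarrow> complex) \<Rightarrow> (nat \<Rightarrow> int) set" where
  "supp N d g = {x \<in> ZN N d. g x \<noteq> 0}"

definition Lp_norm :: "nat \<Rightarrow> nat \<Rightarrow> real \<Rightarrow> ((nat \<Rightarrow> int) \<Rightarrow> complex) \<Rightarrow> real" where
  "Lp_norm N d p f = (\<Sum>x\<in>ZN N d. cmod (f x) powr p) powr (1 / p)"

definition Linf_norm :: "nat \<Rightarrow> nat \<Rightarrow> ((nat \<Rightarrow> int) \<Rightarrow> complex) \<Rightarrow> real" where
  "Linf_norm N d f = Max ((\<lambda>x. cmod (f x)) ` ZN N d)"

end

theory Submission
  imports Defs "HOL-Library.Real_Mod"
begin

text \<open>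
  Put \<open>k = \<lceil>N\<^sup>\<alpha>\<rceil>\<close>, cut \<open>\<int>\<^sub>N\<^sup>d\<close> into \<open>k\<close> blocks of nearly equal size, and pick one
  frequency at random from each block. Let \<open>f\<close> be the sum of the chosen characters, each weighted
  by the relative size of its block. Then \<open>f 0 = 1\<close> and exactly \<open>k\<close> frequencies occur. At
  \<open>x \<noteq> 0\<close>, the value \<open>f x\<close> is a sum of \<open>k\<close> independent variables of size \<open>O(1/k)\<close>, and the
  weights make its mean the full character sum, which is 0. So \<open>\<surd>k f x\<close> has bounded exponential
  moments, the expected value of \<open>\<Sum>\<^bsub>x\<noteq>0\<^esub> |f x|\<^sup>p\<close> is \<open>O(N\<^sup>d k\<^bsup>-p/2\<^esup>)\<close>, and this is bounded because
  \<open>p > 2d/\<alpha>\<close>.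
\<close>

section \<open>Characters\<close>

definition echar :: "nat \<Rightarrow> int \<Rightarrow> complex" where
  "echar N a = cis (2 * pi * real_of_int a / real N)"

lemma norm_echar [simp]: "cmod (echar N a) = 1"
  by (simp add: echar_def)

lemma echar_0 [simp]: "echar N 0 = 1"
  by (simp add: echar_def)

lemma echar_add: "echar N (a + b) = echar N a * echar N b"
  by (simp add: echar_def cis_mult add_divide_distrib distrib_left)

lemma echar_sum: "echar N (\<Sum>j\<in>A. f j) = (\<Prod>j\<in>A. echar N (f j))"
  by (induction A rule: infinite_finite_induct) (auto simp: echar_add)

lemma echar_power: "echar N (int n * a) = echar N a ^ n"
  by (simp add: echar_def DeMoivre mult_ac)

lemma echar_eq_1_iff:
  assumes "N > 0"
  shows "echar N a = 1 \<longleftrightarrow> int N dvd a"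
proof -
  have "echar N a = 1 \<longleftrightarrow> (\<exists>n::int. real_of_int a = real_of_int (n * int N))"
    using assms unfolding echar_def cis_eq_1_iff by (simp add: field_simps)
  also have "\<dots> \<longleftrightarrow> int N dvd a"
    unfolding of_int_eq_iff by (auto simp: dvd_def mult.commute)
  finally show ?thesis .
qed

text \<open>A geometric series whose ratio \<open>echar N c\<close> is an \<open>N\<close>-th root
  of unity other than 1.\<close>

lemma sum_echar_cyclic:
  assumes "N > 0" "\<not> int N dvd c"
  shows "(\<Sum>t\<in>{0..<int N}. echar N (t * c)) = 0"
proof -
  have "(\<Sum>t\<in>{0..<int N}. echar N (t * c)) = (\<Sum>t<N. echar N (int t * c))"
    by (rule sum.reindex_bij_witness[of _ int nat]) auto
  also have "\<dots> = (\<Sum>t<N. echar N c ^ t)"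
    by (simp add: echar_power)
  also have "\<dots> = (echar N c ^ N - 1) / (echar N c - 1)"
    using assms by (intro geometric_sum) (simp add: echar_eq_1_iff)
  also have "echar N c ^ N = 1"
    using assms by (simp flip: echar_power add: echar_eq_1_iff)
  finally show ?thesis by simp
qed

section \<open>Orthogonality of characters on the product group\<close>

lemma dot_commute: "dot d x m = dot d m x"
  by (simp add: dot_def mult.commute)

lemma dot_diff: "dot d x (\<lambda>j. m j - m' j) = dot d x m - dot d x m'"
  by (simp add: dot_def right_diff_distrib sum_subtractf)

text \<open>The sum factors over the coordinates, so one coordinate with a nontrivial character
  makes the whole product vanish.\<close>

lemma sum_echar_dot:
  assumes "N > 0" "j \<in> {1..d}" "\<not> int N dvd c j"
  shows "(\<Sum>x\<in>ZN N d. echar N (dot d x c)) = 0"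
proof -
  have "(\<Sum>x\<in>ZN N d. echar N (dot d x c))
      = (\<Sum>x\<in>{1..d} \<rightarrow>\<^sub>E {0..<int N}. \<Prod>j\<in>{1..d}. echar N (x j * c j))"
    using assms by (simp add: ZN_eq dot_def echar_sum)
  also have "\<dots> = (\<Prod>j\<in>{1..d}. \<Sum>t\<in>{0..<int N}. echar N (t * c j))"
    by (subst prod_sum_PiE) auto
  also have "\<dots> = 0"
    using assms sum_echar_cyclic[of N "c j"] by (subst prod_zero_iff) auto
  finally show ?thesis .
qed

text \<open>Coordinates are representatives in \<open>{0..<int N}\<close>, so distinct ones differ
  by less than \<open>N\<close> in absolute value and remain distinct modulo
  \<open>N\<close>.\<close>

lemma sum_echar_orthogonal:
  assumes "N > 0" "m \<in> ZN N d" "m' \<in> ZN N d"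
  shows "(\<Sum>x\<in>ZN N d. echar N (dot d x m - dot d x m')) = (if m = m' then of_nat (N ^ d) else 0)"
proof (cases "m = m'")
  case True
  then show ?thesis using assms by (simp add: card_ZN)
next
  case False
  have mem: "m \<in> {1..d} \<rightarrow>\<^sub>E {0..<int N}" "m' \<in> {1..d} \<rightarrow>\<^sub>E {0..<int N}"
    using assms by (auto simp: ZN_eq)
  then obtain j where j: "j \<in> {1..d}" "m j \<noteq> m' j"
    using False PiE_ext by blast
  with mem have "m j \<in> {0..<int N}" "m' j \<in> {0..<int N}"
    by (auto simp: PiE_iff)
  hence "\<bar>m j - m' j\<bar> < int N" by auto
  hence "\<not> int N dvd m j - m' j"
    using j dvd_imp_le_int[of "m j - m' j" "int N"] by auto
  thus ?thesis
    using sum_echar_dot[OF \<open>N > 0\<close> j(1), of "\<lambda>j. m j - m' j"] False by (simp add: dot_diff)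
qed

section \<open>Functions prescribed by their Fourier coefficients\<close>

definition char_sum :: "nat \<Rightarrow> nat \<Rightarrow> ((nat \<Rightarrow> int) \<Rightarrow> real) \<Rightarrow> (nat \<Rightarrow> int) \<Rightarrow> complex" where
  "char_sum N d w x = (\<Sum>m\<in>ZN N d. of_real (w m) * echar N (dot d x m))"

text \<open>By orthogonality the Fourier coefficient at \<open>m\<close> is \<open>w m\<close> times
  \<open>N powr (d / 2)\<close>, so sparsity of the weights is sparsity of the spectrum.\<close>

lemma supp_fourier_char_sum:
  assumes "N > 0"
  shows "supp N d (fourier N d (char_sum N d w)) = {m \<in> ZN N d. w m \<noteq> 0}"
proof -
  have "fourier N d (char_sum N d w) m' = 0 \<longleftrightarrow> w m' = 0" if m': "m' \<in> ZN N d" for m'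
  proof -
    have "exp (- 2 * of_real pi * \<i> * of_int (dot d x m') / of_nat N) = echar N (- dot d x m')" for x
      by (simp add: echar_def cis_conv_exp mult_ac)
    hence "(\<Sum>x\<in>ZN N d. char_sum N d w x * exp (- 2 * of_real pi * \<i> * of_int (dot d x m') / of_nat N))
      = (\<Sum>x\<in>ZN N d. \<Sum>m\<in>ZN N d. of_real (w m) * echar N (dot d x m - dot d x m'))"
      by (simp add: char_sum_def sum_distrib_right mult.assoc echar_add[symmetric])
    also have "\<dots> = (\<Sum>m\<in>ZN N d. of_real (w m) * (\<Sum>x\<in>ZN N d. echar N (dot d x m - dot d x m')))"
      by (subst sum.swap) (simp add: sum_distrib_left)
    also have "\<dots> = (\<Sum>m\<in>ZN N d. if m = m' then of_real (w m) * of_nat (N ^ d) else 0)"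
      using assms m' by (intro sum.cong) (auto simp: sum_echar_orthogonal)
    also have "\<dots> = of_real (w m') * of_nat (N ^ d)"
      using m' finite_ZN[OF assms] by simp
    finally show ?thesis
      using assms by (simp add: fourier_def)
  qed
  thus ?thesis by (auto simp: supp_def)
qed

section \<open>Exponential moments\<close>

text \<open>The linear term is kept exact, so that for a variable of mean zero only the quadratic
  term survives averaging.\<close>

lemma exp_le_quadratic:
  fixes x :: real
  assumes "\<bar>x\<bar> \<le> 1"
  shows "exp x \<le> 1 + x + x\<^sup>2"
proof (cases "x \<ge> 0")
  case True
  thus ?thesis using assms exp_bound by auto
next
  case False
  define y where "y = - x"
  have y: "y > 0" using False by (simp add: y_def)
  have "exp x = 1 / exp y" by (simp add: y_def exp_minus inverse_eq_divide)
  also have "\<dots> \<le> 1 / (1 + y)"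
    using y by (intro divide_left_mono) (auto simp: exp_ge_add_one_self)
  also have "\<dots> \<le> 1 - y + y\<^sup>2"
  proof -
    have "(1 - y + y\<^sup>2) * (1 + y) = 1 + y ^ 3" by (simp add: algebra_simps power2_eq_square power3_eq_cube)
    also have "\<dots> \<ge> 1" using y by simp
    finally show ?thesis using y by (simp add: divide_le_eq)
  qed
  finally show ?thesis by (simp add: y_def)
qed

lemma powr_le_exp:
  fixes u p :: real
  assumes "u \<ge> 0" "p > 0"
  shows "u powr p \<le> p powr p * exp u"
proof -
  have "u / p \<le> exp (u / p)" using exp_ge_add_one_self[of "u / p"] by linarith
  hence "u \<le> p * exp (u / p)" using assms by (simp add: field_simps)
  hence "u powr p \<le> (p * exp (u / p)) powr p" using assms by (intro powr_mono2) auto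
  also have "\<dots> = p powr p * exp u" using assms by (simp add: powr_mult exp_powr_real)
  finally show ?thesis .
qed

text \<open>The four units turn \<open>Re (u * z)\<close> into plus or minus \<open>Re z\<close> and
  \<open>Im z\<close>. The largest of these is at least half of \<open>cmod z\<close>, so
  exponential moments of real variables control complex \<open>p\<close>-th moments.\<close>

lemma cmod_powr_le_exp:
  fixes z :: complex and p :: real
  assumes "p > 0"
  shows "cmod z powr p \<le> (2 * p) powr p * (\<Sum>u\<in>{1, -1, \<i>, -\<i>}. exp (Re (u * z)))"
proof -
  define M where "M = max \<bar>Re z\<bar> \<bar>Im z\<bar>"
  have "cmod z powr p \<le> (2 * M) powr p"
    using assms cmod_le[of z] by (intro powr_mono2) (auto simp: M_def)
  also have "\<dots> = 2 powr p * M powr p" by (simp add: powr_mult M_def)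
  also have "\<dots> \<le> 2 powr p * (p powr p * exp M)"
    using assms by (intro mult_left_mono powr_le_exp) (auto simp: M_def)
  also have "\<dots> = (2 * p) powr p * exp M" using assms by (simp add: powr_mult)
  also have "exp M \<le> exp (Re z) + exp (- Re z) + exp (Im z) + exp (- Im z)"
    using exp_gt_zero[of "Re z"] exp_gt_zero[of "- Re z"] exp_gt_zero[of "Im z"] exp_gt_zero[of "- Im z"]
    unfolding M_def max_def abs_real_def by (auto split: if_splits)
  also have "\<dots> = (\<Sum>u\<in>{1, -1, \<i>, -\<i>}. exp (Re (u * z)))"
    by (simp add: complex_eq_iff)
  finally show ?thesis by (simp add: mult_left_mono)
qed

text \<open>A Hoeffding-type bound for independent coordinates. The sum over choice functions
  factors over the blocks, each block costs a factor at most \<open>exp (1 / k)\<close> relative to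
  its size, and the \<open>k\<close> factors multiply to \<open>exp 1\<close>.\<close>

lemma sum_PiE_exp_le:
  fixes r :: "nat \<Rightarrow> 'b \<Rightarrow> real" and B :: "nat \<Rightarrow> 'b set"
  assumes "\<And>j. j < k \<Longrightarrow> finite (B j)"
    and "\<And>j. j < k \<Longrightarrow> (\<Sum>m\<in>B j. r j m) = 0"
    and "\<And>j m. j < k \<Longrightarrow> m \<in> B j \<Longrightarrow> \<bar>r j m\<bar> \<le> 1 / sqrt (real k)"
  shows "(\<Sum>g\<in>PiE {..<k} B. exp (\<Sum>j<k. r j (g j))) \<le> exp 1 * real (card (PiE {..<k} B))"
proof (cases "k = 0")
  case True
  then show ?thesis by simp
next
  case False
  have block: "(\<Sum>m\<in>B j. exp (r j m)) \<le> real (card (B j)) * exp (1 / real k)" if j: "j < k" for j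
  proof -
    have "exp (r j m) \<le> 1 + r j m + 1 / real k" if m: "m \<in> B j" for m
    proof -
      have r: "\<bar>r j m\<bar> \<le> 1 / sqrt (real k)" by (rule assms(3)[OF j m])
      have "1 / sqrt (real k) \<le> 1" using False by (simp add: divide_le_eq)
      hence "exp (r j m) \<le> 1 + r j m + (r j m)\<^sup>2"
        using r by (intro exp_le_quadratic) linarith
      moreover have "(r j m)\<^sup>2 \<le> (1 / sqrt (real k))\<^sup>2"
        using power_mono[OF r, of 2] by simp
      ultimately show ?thesis by (simp add: power_divide)
    qed
    hence "(\<Sum>m\<in>B j. exp (r j m)) \<le> (\<Sum>m\<in>B j. 1 + r j m + 1 / real k)"
      by (intro sum_mono) auto
    also have "\<dots> = real (card (B j)) * (1 + 1 / real k)"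
      using assms(2)[OF j] by (simp add: sum.distrib algebra_simps)
    also have "\<dots> \<le> real (card (B j)) * exp (1 / real k)"
      by (intro mult_left_mono exp_ge_add_one_self) auto
    finally show ?thesis .
  qed
  have "(\<Sum>g\<in>PiE {..<k} B. exp (\<Sum>j<k. r j (g j))) = (\<Prod>j<k. \<Sum>m\<in>B j. exp (r j m))"
    using assms(1) by (subst prod_sum_PiE) (auto simp: exp_sum)
  also have "\<dots> \<le> (\<Prod>j<k. real (card (B j)) * exp (1 / real k))"
    using block by (intro prod_mono) (auto intro: sum_nonneg)
  also have "\<dots> = real (card (PiE {..<k} B)) * exp 1"
    using False by (simp add: prod.distrib card_PiE exp_of_nat_mult[symmetric])
  finally show ?thesis by (simp add: mult.commute)
qed

section \<open>Random choice of frequencies\<close>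

text \<open>Within a residue class the quotient \<open>i div k\<close> determines
  \<open>i\<close>.\<close>

lemma card_mod_class_le: "card {i. i < n \<and> i mod k = j} \<le> n div k + 1"
proof -
  have "inj_on (\<lambda>i. i div k) {i. i < n \<and> i mod k = j}"
    by (rule inj_onI) (metis (mono_tags, lifting) div_mult_mod_eq mem_Collect_eq)
  moreover have "(\<lambda>i. i div k) ` {i. i < n \<and> i mod k = j} \<subseteq> {..n div k}"
    by (auto intro: div_le_mono)
  ultimately have "card {i. i < n \<and> i mod k = j} \<le> card {..n div k}"
    by (intro card_inj_on_le) auto
  thus ?thesis by simp
qed

text \<open>Enumerate \<open>V\<close> and colour each element by its index modulo \<open>k\<close>;
  every colour occurs because \<open>k \<le> card V\<close>.\<close>

lemma balanced_partition:
  fixes V :: "'b set"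
  assumes "finite V" "1 \<le> k" "k \<le> card V"
  obtains h :: "'b \<Rightarrow> nat" where "h ` V = {..<k}"
    "\<And>j. real (card {m \<in> V. h m = j}) \<le> 2 * real (card V) / real k"
proof -
  obtain e where e: "bij_betw e V {0..<card V}"
    using ex_bij_betw_finite_nat[OF assms(1)] by blast
  define h where "h = (\<lambda>m. e m mod k)"
  have img: "e ` V = {0..<card V}" using e by (simp add: bij_betw_def)
  have "h ` V = (\<lambda>i. i mod k) ` {0..<card V}"
    unfolding img[symmetric] by (auto simp: h_def)
  also have "\<dots> = {..<k}"
  proof (intro equalityI subsetI)
    fix j assume "j \<in> {..<k}"
    thus "j \<in> (\<lambda>i. i mod k) ` {0..<card V}" using assms by (intro image_eqI[of _ _ j]) auto
  qed (use assms in auto)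
  finally have 1: "h ` V = {..<k}" .
  have 2: "real (card {m \<in> V. h m = j}) \<le> 2 * real (card V) / real k" for j
  proof -
    have "card {m \<in> V. h m = j} \<le> card {i. i < card V \<and> i mod k = j}"
      using e img by (intro card_inj_on_le[of e]) (auto simp: h_def bij_betw_def inj_on_def)
    also have "\<dots> \<le> card V div k + 1" by (rule card_mod_class_le)
    finally have "real (card {m \<in> V. h m = j}) \<le> real (card V div k) + 1" by linarith
    also have "real (card V div k) \<le> real (card V) / real k" 
      by (rule of_nat_div_le_of_nat)
    \<comment> \<open>The rounding error 1 is absorbed here, which is where the factor 2 comes
      from.\<close>
    also have "1 \<le> real (card V) / real k" using assms by simp
    finally show ?thesis by simp
  qed
  show thesis using that 1 2 by blast
qed

section \<open>From averages over random choices to a single good choice\<close>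

lemma exists_le_average:
  fixes f :: "'a \<Rightarrow> real"
  assumes "finite A" "A \<noteq> {}" "sum f A \<le> real (card A) * c"
  shows "\<exists>a\<in>A. f a \<le> c"
proof (rule ccontr)
  assume "\<not> ?thesis"
  hence "(\<Sum>a\<in>A. c) < sum f A" using assms by (intro sum_strict_mono) auto
  thus False using assms by simp
qed

text \<open>The factor \<open>4 powr p\<close> undoes the scaling by \<open>sqrt k / 4\<close>,
  \<open>(2 * p) powr p\<close> is the price of passing to exponentials, and
  \<open>4 * exp 1\<close> bounds the exponential moments in four directions.\<close>

definition moment_const :: "real \<Rightarrow> real" where
  "moment_const p = 4 powr p * ((2 * p) powr p * (4 * exp 1))"

lemma moment_const_nonneg: "moment_const p \<ge> 0"
  by (simp add: moment_const_def)

text \<open>Of the characters only boundedness by 1 and vanishing mean over \<open>V\<close> enter.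
  A uniform \<open>g\<close> in \<open>P\<close> picks one element per block independently, and the
  weights \<open>b j\<close> make the average of \<open>F g x\<close> over \<open>P\<close> equal to
  the average of \<open>\<phi> x\<close> over \<open>V\<close>.\<close>

lemma exists_sparse_weights:
  fixes V :: "'b set" and X :: "'a set" and \<phi> :: "'a \<Rightarrow> 'b \<Rightarrow> complex" and p :: real
  assumes "finite V" "1 \<le> k" "k \<le> card V" "finite X" "p > 0"
    and norm: "\<And>x m. x \<in> X \<Longrightarrow> m \<in> V \<Longrightarrow> cmod (\<phi> x m) \<le> 1"
    and mean: "\<And>x. x \<in> X \<Longrightarrow> (\<Sum>m\<in>V. \<phi> x m) = 0"
  obtains w :: "'b \<Rightarrow> real" where "card {m \<in> V. w m \<noteq> 0} = k" "sum w V = 1"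
    "(\<Sum>x\<in>X. cmod (\<Sum>m\<in>V. of_real (w m) * \<phi> x m) powr p)
       \<le> moment_const p * real (card X) * real k powr (- p / 2)"
proof -
  obtain h where h: "h ` V = {..<k}"
    and hcard: "\<And>j. real (card {m \<in> V. h m = j}) \<le> 2 * real (card V) / real k"
    using balanced_partition[OF assms(1-3)] by blast
  define B where "B j = {m \<in> V. h m = j}" for j
  define b where "b j = real (card (B j)) / real (card V)" for j
  define P where "P = PiE {..<k} B"
  define F where "F g x = (\<Sum>j<k. of_real (b j) * \<phi> x (g j))" for g x
  \<comment> \<open>Since \<open>b j\<close> is at most \<open>2 / k\<close> and a centred value is
    at most 2 in modulus, this scaling makes each summand at most \<open>1 / sqrt k\<close>.\<close>
  define s where "s = sqrt (real k) / 4"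
  have n: "card V > 0" and k: "k > 0" using assms by auto
  have finB: "finite (B j)" for j using assms by (simp add: B_def)
  have Bne: "B j \<noteq> {}" if "j < k" for j
  proof -
    have "j \<in> h ` V" using that h by simp
    thus ?thesis by (auto simp: B_def)
  qed
  have b_pos: "b j > 0" if "j < k" for j
    using Bne[OF that] finB[of j] n by (simp add: b_def card_gt_0_iff)
  have b_le: "b j \<le> 2 / real k" for j
    using hcard[of j] n by (simp add: b_def B_def divide_le_eq)
  have sum_blocks: "(\<Sum>j<k. \<Sum>m\<in>B j. q m) = (\<Sum>m\<in>V. q m)" for q :: "'b \<Rightarrow> complex"
    unfolding B_def using assms h by (intro sum.group) auto
  have finP: "finite P" using finB by (auto simp: P_def intro: finite_PiE)
  have Pne: "P \<noteq> {}" using Bne by (auto simp: P_def PiE_eq_empty_iff)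

  have mgf: "(\<Sum>g\<in>P. exp (Re (u * (of_real s * F g x)))) \<le> exp 1 * real (card P)"
    if x: "x \<in> X" and u: "u \<in> {1, -1, \<i>, -\<i>}" for x u
  proof -
    \<comment> \<open>Subtracting the block mean \<open>a j\<close> gives each summand mean zero on
      its block. The total is unchanged, because the weighted block means add up to the mean of
      \<open>\<phi> x\<close> over \<open>V\<close>, which is 0.\<close>
    define a where "a j = (\<Sum>m\<in>B j. \<phi> x m) / of_nat (card (B j))" for j
    define r where "r j m = Re (u * (of_real (s * b j) * (\<phi> x m - a j)))" for j m
    have cu: "cmod u = 1" using u by auto
    have ba: "of_real (b j) * a j = (\<Sum>m\<in>B j. \<phi> x m) / of_nat (card V)" if "j < k" for j
      using Bne[OF that] finB[of j] by (simp add: a_def b_def)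
    have "(\<Sum>j<k. of_real (b j) * a j) = (\<Sum>j<k. \<Sum>m\<in>B j. \<phi> x m) / of_nat (card V)"
      by (simp add: ba sum_divide_distrib)
    also have "\<dots> = 0" by (simp add: sum_blocks mean[OF x])
    finally have a0: "(\<Sum>j<k. of_real (b j) * a j) = 0" .
    have centre: "(\<Sum>j<k. r j (g j)) = Re (u * (of_real s * F g x))" for g
    proof -
      have "(\<Sum>j<k. u * (of_real (s * b j) * (\<phi> x (g j) - a j)))
          = u * of_real s * (F g x - (\<Sum>j<k. of_real (b j) * a j))"
        by (simp add: F_def sum_distrib_left sum_subtractf algebra_simps)
      thus ?thesis unfolding r_def Re_sum[symmetric] by (simp only: a0) (simp add: mult.assoc)
    qed
    have "(\<Sum>m\<in>B j. r j m) = 0" if "j < k" for j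
    proof -
      have "(\<Sum>m\<in>B j. \<phi> x m - a j) = 0"
        using Bne[OF that] finB[of j] by (simp add: sum_subtractf a_def)
      hence "(\<Sum>m\<in>B j. u * (of_real (s * b j) * (\<phi> x m - a j))) = 0"
        by (simp flip: sum_distrib_left)
      thus ?thesis by (simp only: r_def Re_sum[symmetric] zero_complex.sel)
    qed
    moreover have "\<bar>r j m\<bar> \<le> 1 / sqrt (real k)" if j: "j < k" and m: "m \<in> B j" for j m
    proof -
      have phi: "cmod (\<phi> x m') \<le> 1" if "m' \<in> B j" for m'
        using norm[OF x, of m'] that by (simp add: B_def)
      have "cmod (\<Sum>m\<in>B j. \<phi> x m) \<le> real (card (B j))"
        using sum_norm_le[of "B j" "\<phi> x" "\<lambda>_. 1"] phi by simp
      hence "cmod (a j) \<le> 1"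
        using Bne[OF j] finB[of j] by (simp add: a_def norm_divide divide_le_eq card_gt_0_iff)
      hence d: "cmod (\<phi> x m - a j) \<le> 2"
        using phi[OF m] norm_triangle_ineq4[of "\<phi> x m" "a j"] by linarith
      have "\<bar>r j m\<bar> \<le> s * b j * cmod (\<phi> x m - a j)"
        unfolding r_def using abs_Re_le_cmod[of "u * (of_real (s * b j) * (\<phi> x m - a j))"] b_pos[OF j]
        by (simp add: norm_mult cu s_def abs_mult)
      also have "\<dots> \<le> s * (2 / real k) * 2"
        using d b_le[of j] b_pos[OF j] by (intro mult_mono) (auto simp: s_def)
      also have "\<dots> = 1 / sqrt (real k)"
        using k by (simp add: s_def field_simps)
      finally show ?thesis .
    qed
    ultimately have "(\<Sum>g\<in>P. exp (\<Sum>j<k. r j (g j))) \<le> exp 1 * real (card P)"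
      unfolding P_def using finB by (intro sum_PiE_exp_le) auto
    thus ?thesis by (simp add: centre)
  qed

  have point: "(\<Sum>g\<in>P. cmod (F g x) powr p)
      \<le> real (card P) * (moment_const p * real k powr (- p / 2))" if x: "x \<in> X" for x
  proof -
    have s: "s > 0" using k by (simp add: s_def)
    have "s powr p * (\<Sum>g\<in>P. cmod (F g x) powr p) = (\<Sum>g\<in>P. cmod (of_real s * F g x) powr p)"
      using s by (simp add: norm_mult powr_mult sum_distrib_left)
    also have "\<dots> \<le> (\<Sum>g\<in>P. (2 * p) powr p * (\<Sum>u\<in>{1, -1, \<i>, -\<i>}. exp (Re (u * (of_real s * F g x)))))"
      by (intro sum_mono cmod_powr_le_exp assms)
    also have "\<dots> = (2 * p) powr p * (\<Sum>u\<in>{1, -1, \<i>, -\<i>}. \<Sum>g\<in>P. exp (Re (u * (of_real s * F g x))))"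
      by (subst sum.swap) (simp only: sum_distrib_left)
    also have "\<dots> \<le> (2 * p) powr p * (\<Sum>u\<in>{1, -1, \<i>, -\<i>}. exp 1 * real (card P))"
      using mgf[OF x] by (intro mult_left_mono sum_mono) auto
    also have "\<dots> = (2 * p) powr p * (4 * exp 1) * real (card P)"
      by (simp add: complex_eq_iff)
    finally have "(\<Sum>g\<in>P. cmod (F g x) powr p) \<le> (2 * p) powr p * (4 * exp 1) * real (card P) / s powr p"
      using s by (simp add: field_simps)
    also have "s powr p = real k powr (p / 2) / 4 powr p"
      using k by (simp add: s_def powr_divide powr_half_sqrt[symmetric] powr_powr)
    finally show ?thesis
      using k by (simp add: moment_const_def powr_minus field_simps)
  qed
  \<comment> \<open>Summing over \<open>x\<close> before selecting \<open>g\<close> yields one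
    choice that serves all points of \<open>X\<close> together.\<close>
  have "(\<Sum>g\<in>P. \<Sum>x\<in>X. cmod (F g x) powr p) = (\<Sum>x\<in>X. \<Sum>g\<in>P. cmod (F g x) powr p)"
    by (rule sum.swap)
  also have "\<dots> \<le> (\<Sum>x\<in>X. real (card P) * (moment_const p * real k powr (- p / 2)))"
    by (intro sum_mono point)
  also have "\<dots> = real (card P) * (moment_const p * real (card X) * real k powr (- p / 2))"
    by (simp only: sum_constant mult_ac)
  finally have "\<exists>g\<in>P. (\<Sum>x\<in>X. cmod (F g x) powr p)
      \<le> moment_const p * real (card X) * real k powr (- p / 2)"
    by (rule exists_le_average[OF finP Pne])
  then obtain g where g: "g \<in> P"
    and bound: "(\<Sum>x\<in>X. cmod (F g x) powr p) \<le> moment_const p * real (card X) * real k powr (- p / 2)"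
    by (rule bexE)

  \<comment> \<open>As \<open>g j\<close> lies in block \<open>j\<close>, the map \<open>h\<close>
    recovers \<open>j\<close> from a chosen element; this makes \<open>g\<close> injective and
    \<open>b (h m)\<close> the right weight.\<close>
  define w where "w m = (if m \<in> g ` {..<k} then b (h m) else 0)" for m
  have gB: "g j \<in> V" "h (g j) = j" if "j < k" for j
    using PiE_mem[OF g[unfolded P_def], of j] that by (auto simp: B_def)
  have inj: "inj_on g {..<k}" by (rule inj_on_inverseI[of _ h]) (simp add: gB)
  have sub: "g ` {..<k} \<subseteq> V" using gB by auto
  have "{m \<in> V. w m \<noteq> 0} = g ` {..<k}"
    using sub b_pos gB by (auto simp: w_def) (metis order_less_irrefl)
  hence w_card: "card {m \<in> V. w m \<noteq> 0} = k" using inj by (simp add: card_image)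
  \<comment> \<open>Left general in \<open>q\<close>: the constant 1 gives the total weight, and
    \<open>\<phi> x\<close> gives the moment bound.\<close>
  have w_sum: "(\<Sum>m\<in>V. of_real (w m) * q m) = (\<Sum>j<k. of_real (b j) * q (g j))"
    for q :: "'b \<Rightarrow> complex"
  proof -
    have "(\<Sum>m\<in>V. of_real (w m) * q m) = (\<Sum>m\<in>g ` {..<k}. of_real (w m) * q m)"
      using sub assms by (intro sum.mono_neutral_right) (auto simp: w_def)
    also have "\<dots> = (\<Sum>j<k. of_real (w (g j)) * q (g j))"
      by (simp add: sum.reindex[OF inj])
    also have "\<dots> = (\<Sum>j<k. of_real (b j) * q (g j))"
      by (intro sum.cong) (auto simp: w_def gB)
    finally show ?thesis .
  qed
  have w_total: "sum w V = 1"
  proof -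
    have "of_real (sum w V) = (\<Sum>j<k. of_real (b j) :: complex)" using w_sum[of "\<lambda>_. 1"] by simp
    also have "\<dots> = (\<Sum>j<k. \<Sum>m\<in>B j. 1) / of_nat (card V)"
      by (simp add: b_def sum_divide_distrib)
    also have "\<dots> = of_real 1" unfolding sum_blocks using n by simp
    finally show ?thesis by (simp only: of_real_eq_iff)
  qed
  show thesis
    using bound unfolding F_def w_sum[symmetric] by (rule that[OF w_card w_total])
qed

section \<open>The extremal functions\<close>

text \<open>Total weight 1 forces the value 1 at the origin, which bounds the maximum from below;
  all other points are covered by the moment bound.\<close>

lemma exists_sparse_char_sum:
  fixes d :: nat and \<alpha> p :: real
  assumes "d \<ge> 1" and "0 < \<alpha>" and "\<alpha> < real d" and "2 * real d / \<alpha> < p" and "N \<ge> 1"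
  shows "\<exists>f. real N powr \<alpha> \<le> real (card (supp N d (fourier N d f))) \<and>
      real (card (supp N d (fourier N d f))) \<le> 2 * real N powr \<alpha> \<and>
      Lp_norm N d p f \<le> (1 + moment_const p) powr (1 / p) \<and> Linf_norm N d f \<ge> 1"
proof -
  define k where "k = nat \<lceil>real N powr \<alpha>\<rceil>"
  have N: "N > 0" and N1: "real N powr \<alpha> \<ge> 1"
    using assms by (auto simp: ge_one_powr_ge_zero)
  have "2 * real d / \<alpha> > 0" using assms by simp
  hence p: "p > 0" using assms by linarith
  have k_ge: "real N powr \<alpha> \<le> real k" unfolding k_def by (rule real_nat_ceiling_ge)
  \<comment> \<open>Rounding up adds less than 1, and 1 is at most
    \<open>N powr \<alpha>\<close>.\<close>
  have k_le: "real k \<le> 2 * real N powr \<alpha>" using N1 unfolding k_def by linarith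
  have k1: "1 \<le> k" using k_ge N1 by linarith
  have kn: "k \<le> card (ZN N d)"
  proof -
    have "real N powr \<alpha> \<le> real N powr real d" using assms by (intro powr_mono) auto
    also have "\<dots> = real (N ^ d)" using N by (simp add: powr_realpow)
    finally show ?thesis using N unfolding k_def by (simp add: card_ZN nat_le_iff ceiling_le_iff)
  qed
  \<comment> \<open>The origin must be \<open>undefined\<close> outside \<open>{1..d}\<close> to
    belong to the carrier.\<close>
  define o0 :: "nat \<Rightarrow> int" where "o0 = restrict (\<lambda>_. 0) {1..d}"
  have o0: "o0 \<in> ZN N d" using N by (auto simp: ZN_eq o0_def)
  have dot0: "dot d m o0 = 0" for m by (simp add: dot_def o0_def)
  have fin: "finite (ZN N d)" using N by (rule finite_ZN)
  \<comment> \<open>Orthogonality with the roles of points and frequencies exchanged, comparing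
    \<open>x\<close> with the origin.\<close>
  have mean: "(\<Sum>m\<in>ZN N d. echar N (dot d x m)) = 0" if "x \<in> ZN N d - {o0}" for x
    using sum_echar_orthogonal[OF N, of x d o0] that o0 by (auto simp: dot0 dot_commute[of d x])
  obtain w where w: "card {m \<in> ZN N d. w m \<noteq> 0} = k" "sum w (ZN N d) = 1"
    and bound: "(\<Sum>x\<in>ZN N d - {o0}. cmod (char_sum N d w x) powr p)
        \<le> moment_const p * real (card (ZN N d - {o0})) * real k powr (- p / 2)"
    using exists_sparse_weights[OF fin k1 kn finite_Diff[OF fin] p, of "{o0}" "\<lambda>x m. echar N (dot d x m)"] mean
    unfolding char_sum_def by auto
  have at0: "char_sum N d w o0 = 1"
    using w(2) by (simp add: char_sum_def dot_commute[of d o0] dot0 flip: of_real_sum)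
  \<comment> \<open>The hypothesis on \<open>p\<close> enters here: \<open>\<alpha> * p / 2\<close>
    exceeds \<open>d\<close>, so the decay \<open>k powr (- p / 2)\<close> outweighs the number of
    points.\<close>
  have "real N ^ d \<le> real k powr (p / 2)"
  proof -
    have "real d \<le> \<alpha> * (p / 2)" using assms by (simp add: field_simps)
    hence "real N powr real d \<le> real N powr (\<alpha> * (p / 2))" using assms by (intro powr_mono) auto
    also have "\<dots> = (real N powr \<alpha>) powr (p / 2)" by (simp add: powr_powr)
    also have "\<dots> \<le> real k powr (p / 2)" using k_ge p by (intro powr_mono2) auto
    finally show ?thesis using N by (simp add: powr_realpow)
  qed
  moreover have "real (card (ZN N d - {o0})) \<le> real N ^ d"
    using card_mono[OF fin Diff_subset[of _ "{o0}"]] N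
    by (metis card_ZN of_nat_le_iff of_nat_power)
  ultimately have "real (card (ZN N d - {o0})) \<le> real k powr (p / 2)"
    by linarith
  hence "real (card (ZN N d - {o0})) * real k powr (- p / 2) \<le> 1"
    using k1 by (simp add: powr_minus field_simps)
  hence "moment_const p * (real (card (ZN N d - {o0})) * real k powr (- p / 2)) \<le> moment_const p * 1"
    by (intro mult_left_mono moment_const_nonneg)
  \<comment> \<open>The origin is split off and contributes exactly 1.\<close>
  hence "(\<Sum>x\<in>ZN N d. cmod (char_sum N d w x) powr p) \<le> 1 + moment_const p"
    using bound at0 by (simp add: sum.remove[OF fin o0] mult.assoc)
  hence "Lp_norm N d p (char_sum N d w) \<le> (1 + moment_const p) powr (1 / p)"
    unfolding Lp_norm_def using p by (intro powr_mono2) (auto intro: sum_nonneg)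
  moreover have "cmod (char_sum N d w o0) \<le> Linf_norm N d (char_sum N d w)"
    unfolding Linf_norm_def using fin o0 by (intro Max_ge) auto
  hence "1 \<le> Linf_norm N d (char_sum N d w)" by (simp add: at0)
  moreover have "card (supp N d (fourier N d (char_sum N d w))) = k"
    using w(1) by (simp add: supp_fourier_char_sum[OF N])
  ultimately show ?thesis using k_ge k_le by blast
qed

theorem proposition7:
  fixes d :: nat and \<alpha> p :: real
  assumes "d \<ge> 1" and "0 < \<alpha>" and "\<alpha> < real d" and "2 * real d / \<alpha> < p"
  shows "\<exists>f :: nat \<Rightarrow> (nat \<Rightarrow> int) \<Rightarrow> complex.
    (\<exists>C1 > 0. \<exists>C2 > 0. \<forall>N \<ge> 1.
        C1 * real N powr \<alpha> \<le> real (card (supp N d (fourier N d (f N)))) \<and>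
        real (card (supp N d (fourier N d (f N)))) \<le> C2 * real N powr \<alpha>) \<and>
    (\<exists>C > 0. \<exists>C0 > 0. \<forall>N \<ge> 1.
        Lp_norm N d p (f N) \<le> C \<and> Linf_norm N d (f N) > C0)"
proof -
  from exists_sparse_char_sum[OF assms] obtain f where f: "\<And>N. N \<ge> 1 \<Longrightarrow>
      real N powr \<alpha> \<le> real (card (supp N d (fourier N d (f N)))) \<and>
      real (card (supp N d (fourier N d (f N)))) \<le> 2 * real N powr \<alpha> \<and>
      Lp_norm N d p (f N) \<le> (1 + moment_const p) powr (1 / p) \<and> Linf_norm N d (f N) \<ge> 1"
    by metis
  have C: "(1 + moment_const p) powr (1 / p) > 0"
    using moment_const_nonneg[of p] by simp
  show ?thesis
  proof (intro exI[of _ f] conjI)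
    show "\<exists>C1>0. \<exists>C2>0. \<forall>N\<ge>1.
        C1 * real N powr \<alpha> \<le> real (card (supp N d (fourier N d (f N)))) \<and>
        real (card (supp N d (fourier N d (f N)))) \<le> C2 * real N powr \<alpha>"
      using f by (intro exI[of _ 1] exI[of _ 2] conjI) auto
    \<comment> \<open>The maximum is known to be at least 1, so \<open>1/2\<close> leaves room for
      the strict inequality.\<close>
    show "\<exists>C>0. \<exists>C0>0. \<forall>N\<ge>1. Lp_norm N d p (f N) \<le> C \<and> Linf_norm N d (f N) > C0"
      using f C by (intro exI[of _ "(1 + moment_const p) powr (1 / p)"] exI[of _ "1/2"] conjI) force+
  qed
qed

end
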